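(* Let $n\geq 2$ be a fixed positive integer. The variety of monoids generated by the stalactic monoid $\mathrm{stal}_n$ of rank $n$ is: (1) a proper subvariety of $\mathbf{B}$; (2) the join of $\mathbf{Comm}$ and $\mathbf{RRB}$; (3) defined by the single identity $xyx=yxx$; (4) equal to the variety of monoids generated by the (infinite-rank) stalactic monoid $\mathrm{stal}$.
   Context: Varieties are varieties of monoids. $\mathbf{Comm}$ is the variety of commutative monoids; $\mathbf{B}$ is the variety of monoids generated by the bicyclic monoid; $\mathbf{RRB}$ is the variety of right regular bands (monoids satisfying $x^2=x$ and $xyx=yx$). $\mathbb{N}=\{1,2,3,\dots\}$, $[n]=\{1,\dots,n\}$, and $X^*$ is the free monoid on $X$. A stalactic tableau is a finite array of positive integers in which columns are top-aligned and two symbols appear in the same column if and only if they are equal. Insertion of a symbol $a$ into a stalactic tableau $T$: if $a$ does not appear in $T$, add $a$ to the left of the top row of $T$ (as a new leftmost column); if $a$ appears in $T$, add $a$ to the bottom of the unique column containing $a$. For $u\in\mathbb{N}^*$, $\mathrm{P}_{\mathrm{stal}}(u)$ is the tableau obtained from the empty tableau by inserting the symbols of $u$ from right to left. The relation $u\equiv_{\mathrm{stal}}v\iff \mathrm{P}_{\mathrm{stal}}(u)=\mathrm{P}_{\mathrm{stal}}(v)$ is a congruence; $\mathrm{stal}=\mathbb{N}^*/{\equiv_{\mathrm{stal}}}$ and $\mathrm{stal}_n=[n]^*/{\equiv_{\mathrm{stal}}}$. *)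

theory Defs
  imports "HOL-Algebra.Product_Groups" "HOL-Library.Infinite_Typeclass"
begin

section \<open>Varieties of monoids\<close>

definition hom_images :: "'a monoid set \<Rightarrow> 'b monoid set" where
  "hom_images K = {N. monoid N \<and>
     (\<exists>M\<in>K. \<exists>h\<in>hom M N. h \<one>\<^bsub>M\<^esub> = \<one>\<^bsub>N\<^esub> \<and> h ` carrier M = carrier N)}"

definition submonoids :: "'a monoid set \<Rightarrow> 'a monoid set" where
  "submonoids K = {M\<lparr>carrier := S\<rparr> | M S. M \<in> K \<and> submonoid S M}"

text \<open>\<^const>\<open>product_group\<close> is the direct product with componentwise operations; its definition makes
  sense for arbitrary monoids.\<close>

definition direct_products :: "'a monoid set \<Rightarrow> ('i \<Rightarrow> 'a) monoid set" where
  "direct_products K = {product_group I G | I G. \<forall>i\<in>I. G i \<in> K}"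

text \<open>Classes of monoids are represented by sets of monoids whose carriers live in a type \<open>'u\<close>,
  the universe. A direct product of such monoids has its carrier in a larger type, so
  closure under homomorphic images, submonoids and direct products is expressed by the composite
  operator \<open>HSP\<close>, which comes back to \<open>'u\<close>.

  The index type \<open>'u list \<times> 'u list\<close> is no restriction. Let \<open>N\<close> be a monoid on \<open>'u\<close> that is an
  image of a submonoid \<open>S\<close> of a direct product with an arbitrary index set. We may assume that \<open>S\<close> is
  generated by one preimage of each element of \<open>N\<close>. Then the elements of \<open>S\<close> are named by words over
  \<open>'u\<close>, and it suffices to keep, for each pair of words naming different elements, one coordinate
  at which they differ.\<close>

definition HSP :: "'u monoid set \<Rightarrow> 'u monoid set" where
  "HSP K = hom_images (submonoids (direct_products K :: ('u list \<times> 'u list \<Rightarrow> 'u) monoid set))"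

definition variety :: "'u monoid set \<Rightarrow> bool" where
  "variety V \<longleftrightarrow> (\<forall>M\<in>V. monoid M) \<and> HSP V \<subseteq> V"

definition generated_variety :: "'u monoid set \<Rightarrow> 'u monoid set" where
  "generated_variety K = \<Inter>{V. variety V \<and> K \<subseteq> V}"

text \<open>The given monoid \<open>M\<close> need not live in the universe, so it is represented by its isomorphic
  copies there. Such copies exist whenever \<open>'u\<close> is infinite and the carrier of \<open>M\<close> is countable
  (lemma \<open>copies_nonempty\<close> below).\<close>

definition copies :: "'a monoid \<Rightarrow> 'u monoid set" where
  "copies M = {N. monoid N \<and> N \<cong> M}"

definition variety_of :: "'a monoid \<Rightarrow> 'u monoid set" where
  "variety_of M = generated_variety (copies M)"

definition variety_join :: "'u monoid set \<Rightarrow> 'u monoid set \<Rightarrow> 'u monoid set" where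
  "variety_join V W = generated_variety (V \<union> W)"

definition proper_subvariety :: "'u monoid set \<Rightarrow> 'u monoid set \<Rightarrow> bool" where
  "proper_subvariety V W \<longleftrightarrow> variety V \<and> variety W \<and> V \<subset> W"

lemma HSP_mono:
  assumes "K \<subseteq> L"
  shows "HSP K \<subseteq> HSP L"
proof -
  have P: "direct_products A \<subseteq> direct_products B" if "A \<subseteq> B" for A B :: "'a monoid set"
  proof
    fix M assume "M \<in> (direct_products A :: ('b \<Rightarrow> 'a) monoid set)"
    then obtain I G where "M = product_group I G" "\<forall>i\<in>I. G i \<in> A"
      unfolding direct_products_def by (elim CollectE exE conjE)
    with that show "M \<in> direct_products B"
      unfolding direct_products_def by (intro CollectI exI[of _ I] exI[of _ G]) (simp add: subset_iff)
  qed
  have S: "submonoids A \<subseteq> submonoids B" if "A \<subseteq> B" for A B :: "'b monoid set"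
  proof
    fix N assume "N \<in> submonoids A"
    then obtain M T where "N = M\<lparr>carrier := T\<rparr>" "M \<in> A" "submonoid T M"
      unfolding submonoids_def by (elim CollectE exE conjE)
    with that show "N \<in> submonoids B"
      unfolding submonoids_def by (intro CollectI exI[of _ M] exI[of _ T]) (simp add: subset_iff)
  qed
  have H: "hom_images A \<subseteq> hom_images B" if "A \<subseteq> B" for A B :: "'b monoid set"
  proof
    fix N assume "N \<in> (hom_images A :: 'c monoid set)"
    then obtain M h where "monoid N" "M \<in> A" "h \<in> hom M N"
        "h \<one>\<^bsub>M\<^esub> = \<one>\<^bsub>N\<^esub> \<and> h ` carrier M = carrier N"
      unfolding hom_images_def by (elim CollectE bexE conjE) blast
    with that show "N \<in> hom_images B"
      unfolding hom_images_def by (intro CollectI conjI bexI[of _ h] bexI[of _ M]) (simp_all add: subset_iff)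
  qed
  show ?thesis
    unfolding HSP_def by (intro H S P assms)
qed

lemma HSP_monoid: "N \<in> HSP K \<Longrightarrow> monoid N"
  unfolding HSP_def hom_images_def by (elim CollectE conjE)

lemma variety_monoids: "variety {N. monoid N}"
  unfolding variety_def using HSP_monoid by blast

lemma generated_variety_least: "variety V \<Longrightarrow> K \<subseteq> V \<Longrightarrow> generated_variety K \<subseteq> V"
  unfolding generated_variety_def by (intro Inter_lower) simp

lemma variety_generated_variety:
  assumes "\<And>M. M \<in> K \<Longrightarrow> monoid M"
  shows "variety (generated_variety K)"
proof -
  have "generated_variety K \<subseteq> {N. monoid N}"
    using assms by (intro generated_variety_least variety_monoids) auto
  moreover have "HSP (generated_variety K) \<subseteq> V" if "variety V" "K \<subseteq> V" for V
    using HSP_mono[OF generated_variety_least[OF that]] that(1)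
    unfolding variety_def by (elim conjE) (rule subset_trans)
  then have "HSP (generated_variety K) \<subseteq> generated_variety K"
    by (subst (2) generated_variety_def) (intro Inter_greatest, simp)
  ultimately show ?thesis
    unfolding variety_def by blast
qed

lemma copies_nonempty:
  fixes M :: "'a monoid"
  assumes "monoid M" "countable (carrier M)"
  shows "(copies M :: 'u::infinite monoid set) \<noteq> {}"
proof -
  interpret monoid M by fact
  obtain g :: "nat \<Rightarrow> 'u" where g: "inj g"
    using infinite_countable_subset[OF infinite_UNIV] by blast
  define f where "f = g \<circ> to_nat_on (carrier M)"
  define k where "k = the_inv_into (carrier M) f"
  have f: "inj_on f (carrier M)"
    unfolding f_def using assms(2) g
    by (intro comp_inj_on inj_on_to_nat_on) (auto intro: inj_on_subset)
  have k: "k (f x) = x" if "x \<in> carrier M" for x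
    unfolding k_def using f that by (rule the_inv_into_f_f)
  define N where "N = \<lparr>carrier = f ` carrier M, mult = (\<lambda>x y. f (k x \<otimes>\<^bsub>M\<^esub> k y)), one = f \<one>\<^bsub>M\<^esub>\<rparr>"
  have "monoid N"
    by (rule monoidI) (auto simp: N_def k m_assoc)
  moreover have "k \<in> iso N M"
    using f by (auto simp: iso_def hom_def N_def k bij_betw_def inj_on_def image_image)
  ultimately show ?thesis
    by (auto simp: copies_def is_iso_def)
qed


section \<open>Identities\<close>

text \<open>Variables are natural numbers, so an identity is a pair of words over \<open>nat\<close>.\<close>

definition eval_word :: "'a monoid \<Rightarrow> (nat \<Rightarrow> 'a) \<Rightarrow> nat list \<Rightarrow> 'a" where
  "eval_word M \<theta> w = foldr (\<lambda>x a. \<theta> x \<otimes>\<^bsub>M\<^esub> a) w \<one>\<^bsub>M\<^esub>"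

definition satisfies :: "'a monoid \<Rightarrow> nat list \<times> nat list \<Rightarrow> bool" where
  "satisfies M e \<longleftrightarrow>
     (\<forall>\<theta> \<in> UNIV \<rightarrow> carrier M. eval_word M \<theta> (fst e) = eval_word M \<theta> (snd e))"

definition models :: "(nat list \<times> nat list) set \<Rightarrow> 'u monoid set" where
  "models \<Sigma> = {M. monoid M \<and> (\<forall>e\<in>\<Sigma>. satisfies M e)}"

definition Comm :: "'u monoid set" where
  "Comm = {M. comm_monoid M}"

text \<open>Right regular bands: \<open>xx = x\<close> and \<open>xyx = yx\<close>.\<close>

definition RRB :: "'u monoid set" where
  "RRB = models {([0, 0], [0]), ([0, 1, 0], [1, 0])}"


section \<open>The bicyclic monoid\<close>

text \<open>The monoid presented by \<open>\<langle>p, q | pq = 1\<rangle>\<close>; the pair \<open>(i, j)\<close> stands for the normal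
  form \<open>q\<^sup>i p\<^sup>j\<close>. The subtractions are truncated: one of the two differences is always \<open>0\<close>.\<close>

definition bicyclic :: "(nat \<times> nat) monoid" where
  "bicyclic = \<lparr>carrier = UNIV,
     mult = (\<lambda>(i, j) (k, l). (i + (k - j), l + (j - k))),
     one = (0, 0)\<rparr>"

lemma monoid_bicyclic: "monoid bicyclic"
proof (rule monoidI)
  fix x y z :: "nat \<times> nat"
  obtain i j k l m p where xyz: "x = (i, j)" "y = (k, l)" "z = (m, p)"
    by (metis surj_pair)
  have "i + (k - j) + (m - (l + (j - k))) = i + (k + (m - l) - j)"
    by (cases "j \<le> k") simp_all
  moreover have "p + (l + (j - k) - m) = p + (l - m) + (j - (k + (m - l)))"
    by (cases "l \<le> m") simp_all
  ultimately show "x \<otimes>\<^bsub>bicyclic\<^esub> y \<otimes>\<^bsub>bicyclic\<^esub> z = x \<otimes>\<^bsub>bicyclic\<^esub> (y \<otimes>\<^bsub>bicyclic\<^esub> z)"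
    by (simp add: bicyclic_def xyz)
qed (simp_all add: bicyclic_def split: prod.splits)

definition variety_B :: "'u monoid set" where
  "variety_B = variety_of bicyclic"


section \<open>Stalactic monoids\<close>

text \<open>A tableau is the list of its columns from left to right, each column being read from top
  to bottom.\<close>

definition stal_insert :: "nat \<Rightarrow> nat list list \<Rightarrow> nat list list" where
  "stal_insert a T =
     (if \<exists>c\<in>set T. a \<in> set c then map (\<lambda>c. if a \<in> set c then c @ [a] else c) T else [a] # T)"

text \<open>\<^const>\<open>foldr\<close> inserts the rightmost symbol of the word first.\<close>

definition P_stal :: "nat list \<Rightarrow> nat list list" where
  "P_stal u = foldr stal_insert u []"

definition stal_equiv :: "nat set \<Rightarrow> (nat list \<times> nat list) set" where
  "stal_equiv A = {(u, v). u \<in> lists A \<and> v \<in> lists A \<and> P_stal u = P_stal v}"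

definition stal_over :: "nat set \<Rightarrow> nat list set monoid" where
  "stal_over A = \<lparr>carrier = lists A // stal_equiv A,
     mult = (\<lambda>X Y. stal_equiv A `` {u @ v | u v. u \<in> X \<and> v \<in> Y}),
     one = stal_equiv A `` {[]}\<rparr>"

definition stal :: "nat list set monoid" where
  "stal = stal_over {1..}"

definition stal_rank :: "nat \<Rightarrow> nat list set monoid" where
  "stal_rank n = stal_over {1..n}"

lemma P_stal_eq: "P_stal u = map (\<lambda>a. replicate (count_list u a) a) (remdups u)"
proof (induction u)
  case (Cons a u)
  have "a \<in> set u \<longleftrightarrow> (\<exists>c\<in>set (P_stal u). a \<in> set c)"
    unfolding Cons.IH by (auto simp: count_list_0_iff)
  then show ?case
    using Cons.IH
    by (auto simp: P_stal_def stal_insert_def count_list_0_iff replicate_append_same)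
qed (simp add: P_stal_def)

lemma P_stal_eq_iff:
  "P_stal u = P_stal v \<longleftrightarrow> remdups u = remdups v \<and> (\<forall>a. count_list u a = count_list v a)"
proof
  have hd_P: "map hd (P_stal w) = remdups w" for w
    by (auto simp: P_stal_eq count_list_0_iff intro!: map_idI)
  assume P: "P_stal u = P_stal v"
  then have r: "remdups u = remdups v"
    by (metis hd_P)
  then have s: "set u = set v"
    by (metis set_remdups)
  have "count_list u a = count_list v a" if "a \<in> set u" for a
    using P r s that by (auto simp: P_stal_eq)
  with r s show "remdups u = remdups v \<and> (\<forall>a. count_list u a = count_list v a)"
    by (metis count_list_0_iff)
qed (simp add: P_stal_eq)

lemma remdups_append_cong:
  "remdups u = remdups u' \<Longrightarrow> remdups v = remdups v' \<Longrightarrow> remdups (u @ v) = remdups (u' @ v')"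
proof -
  have "remdups (u @ v) = filter (\<lambda>x. x \<notin> set v) (remdups u) @ remdups v" for u v :: "'a list"
    by (induction u) auto
  then show "remdups u = remdups u' \<Longrightarrow> remdups v = remdups v' \<Longrightarrow> ?thesis"
    by (metis set_remdups)
qed

lemma equiv_stal: "equiv (lists A) (stal_equiv A)"
  by (auto simp: equiv_def refl_on_def sym_def trans_def stal_equiv_def)

lemma stal_congruence:
  "(u, u') \<in> stal_equiv A \<Longrightarrow> (v, v') \<in> stal_equiv A \<Longrightarrow> (u @ v, u' @ v') \<in> stal_equiv A"
  unfolding stal_equiv_def by (auto simp: P_stal_eq_iff intro: remdups_append_cong)

lemma stal_mult_class:
  assumes "u \<in> lists A" "v \<in> lists A"
  shows "stal_equiv A `` {u} \<otimes>\<^bsub>stal_over A\<^esub> stal_equiv A `` {v} = stal_equiv A `` {u @ v}"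
proof -
  have "(u @ v, w) \<in> stal_equiv A"
    if "(u, u') \<in> stal_equiv A" "(v, v') \<in> stal_equiv A" "(u' @ v', w) \<in> stal_equiv A" for u' v' w
    using stal_congruence[OF that(1,2)] that(3) equiv_stal by (meson equivE transD)
  moreover have "(u, u) \<in> stal_equiv A" "(v, v) \<in> stal_equiv A"
    using assms by (auto simp: stal_equiv_def)
  ultimately show ?thesis
    unfolding stal_over_def by fastforce
qed

lemma monoid_stal_over: "monoid (stal_over A)"
proof (rule monoidI)
  have c: "\<exists>u\<in>lists A. X = stal_equiv A `` {u}" if "X \<in> carrier (stal_over A)" for X
    using that by (auto simp: stal_over_def elim!: quotientE)
  have i: "stal_equiv A `` {u} \<in> carrier (stal_over A)" if "u \<in> lists A" for u
    using that by (auto simp: stal_over_def intro: quotientI)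
  have o: "\<one>\<^bsub>stal_over A\<^esub> = stal_equiv A `` {[]}"
    by (simp add: stal_over_def)
  have app: "u @ v \<in> lists A" if "u \<in> lists A" "v \<in> lists A" for u v
    using that by simp
  show "\<one>\<^bsub>stal_over A\<^esub> \<in> carrier (stal_over A)"
    using i o by simp
  fix X Y Z
  assume X: "X \<in> carrier (stal_over A)"
  then obtain u where u: "u \<in> lists A" "X = stal_equiv A `` {u}" using c by blast
  show "\<one>\<^bsub>stal_over A\<^esub> \<otimes>\<^bsub>stal_over A\<^esub> X = X" "X \<otimes>\<^bsub>stal_over A\<^esub> \<one>\<^bsub>stal_over A\<^esub> = X"
    using u stal_mult_class[of "[]" A u] stal_mult_class[of u A "[]"] o by auto
  assume Y: "Y \<in> carrier (stal_over A)"
  then obtain v where v: "v \<in> lists A" "Y = stal_equiv A `` {v}" using c by blast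
  show "X \<otimes>\<^bsub>stal_over A\<^esub> Y \<in> carrier (stal_over A)"
    using i[OF app[OF u(1) v(1)]] u v by (simp only: stal_mult_class)
  assume "Z \<in> carrier (stal_over A)"
  then obtain w where w: "w \<in> lists A" "Z = stal_equiv A `` {w}" using c by blast
  show "X \<otimes>\<^bsub>stal_over A\<^esub> Y \<otimes>\<^bsub>stal_over A\<^esub> Z = X \<otimes>\<^bsub>stal_over A\<^esub> (Y \<otimes>\<^bsub>stal_over A\<^esub> Z)"
    using u v w app by (simp only: stal_mult_class append_assoc)
qed

end

theory Submission
  imports Defs
begin

text \<open>All the classes of monoids to be compared coincide with the class defined by \<open>xyx = yxx\<close>, or, in
  the case of the bicyclic monoid, contain it properly. The whole proof rests on one observation: the
  identity \<open>xyx = yxx\<close> allows every occurrence of a letter in a word to be moved to the right until it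
  meets the last occurrence of that letter. A word \<open>u\<close> is thereby rewritten to the column reading
  \<open>concat (P_stal u)\<close> of its stalactic tableau (\<open>word_value_P_stal\<close>). Hence a monoid with
  \<open>xyx = yxx\<close> satisfies every identity \<open>u = v\<close> whose two sides have the same tableau, that
  is, in which each letter occurs equally often in \<open>u\<close> and \<open>v\<close> and the last occurrences come in the
  same order.

  With Birkhoff's theorem (\<open>Birkhoff\<close>) this gives the criterion \<open>models_subset_generated_variety\<close>:
  if only identities between words with equal tableaux hold throughout \<open>K\<close>, then the variety
  generated by \<open>K\<close> contains all models of \<open>xyx = yxx\<close>. It remains to find, for each generating class,
  substitutions that detect the number of occurrences of a letter \<open>x\<close> and, for two letters, which one
  occurs last:

  \<^item> in a stalactic monoid over at least two letters, sending \<open>x\<close>, \<open>y\<close> to two generators and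
    all other letters to the identity element does both;
  \<^item> the additive monoid of natural numbers, which is commutative, counts, and the two-element right
    zero semigroup with an identity element adjoined, which is a right regular band, returns the last
    letter;
  \<^item> in the bicyclic monoid, the powers of \<open>p\<close> count, and \<open>x \<mapsto> p\<close>, \<open>y \<mapsto> q\<^sup>m\<close> with \<open>m\<close> large detects
    whether \<open>x\<close> occurs after the last \<open>y\<close>.

  Stalactic monoids, commutative monoids and right regular bands satisfy \<open>xyx = yxx\<close>, so they generate
  nothing else. The bicyclic monoid does not, because \<open>pqp = p\<close> while \<open>qpp\<close> is in normal form.\<close>

section \<open>Values of words\<close>

text \<open>The type of variables is arbitrary because the proof of Birkhoff's theorem evaluates words whose
  letters are the elements of a monoid.\<close>

definition word_value :: "('a, 'm) monoid_scheme \<Rightarrow> ('x \<Rightarrow> 'a) \<Rightarrow> 'x list \<Rightarrow> 'a" where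
  "word_value M \<theta> w = foldr (\<lambda>x a. \<theta> x \<otimes>\<^bsub>M\<^esub> a) w \<one>\<^bsub>M\<^esub>"

lemma eval_word_eq: "eval_word M \<theta> w = word_value M \<theta> w"
  by (simp add: eval_word_def word_value_def)

lemma word_value_Nil [simp]: "word_value M \<theta> [] = \<one>\<^bsub>M\<^esub>"
  and word_value_Cons [simp]: "word_value M \<theta> (x # w) = \<theta> x \<otimes>\<^bsub>M\<^esub> word_value M \<theta> w"
  by (simp_all add: word_value_def)

lemma word_value_map: "word_value M \<theta> (map \<rho> w) = word_value M (\<theta> \<circ> \<rho>) w"
  by (induction w) simp_all

lemma word_value_cong: "(\<And>x. x \<in> set w \<Longrightarrow> \<theta> x = \<eta> x) \<Longrightarrow> word_value M \<theta> w = word_value M \<eta> w"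
  by (induction w) simp_all

lemma word_value_carrier_update [simp]: "word_value (M\<lparr>carrier := S\<rparr>) \<theta> w = word_value M \<theta> w"
  by (induction w) simp_all

lemma (in monoid) word_value_closed:
  "(\<And>x. x \<in> set w \<Longrightarrow> \<theta> x \<in> carrier G) \<Longrightarrow> word_value G \<theta> w \<in> carrier G"
  by (induction w) auto

lemma (in monoid) word_value_append:
  assumes "\<And>x. x \<in> set u \<Longrightarrow> \<theta> x \<in> carrier G" "\<And>x. x \<in> set v \<Longrightarrow> \<theta> x \<in> carrier G"
  shows "word_value G \<theta> (u @ v) = word_value G \<theta> u \<otimes> word_value G \<theta> v"
  using assms by (induction u) (simp_all add: word_value_closed m_assoc)

lemma word_value_hom:
  assumes "monoid M" "h \<in> hom M N" "h \<one>\<^bsub>M\<^esub> = \<one>\<^bsub>N\<^esub>" "\<And>x. x \<in> set w \<Longrightarrow> \<theta> x \<in> carrier M"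
  shows "h (word_value M \<theta> w) = word_value N (h \<circ> \<theta>) w"
  using assms(4)
  by (induction w) (simp_all add: assms(3) hom_mult[OF assms(2)] monoid.word_value_closed[OF assms(1)])

lemma word_value_product:
  assumes "i \<in> I"
  shows "word_value (product_group I G) \<theta> w i = word_value (G i) (\<lambda>x. \<theta> x i) w"
  using assms by (induction w) simp_all

lemma monoid_product:
  assumes "\<And>i. i \<in> I \<Longrightarrow> monoid (G i)"
  shows "monoid (product_group I G)"
proof (rule monoidI)
  show "\<one>\<^bsub>product_group I G\<^esub> \<in> carrier (product_group I G)"
    using assms by (auto simp: monoid.one_closed)
qed (use assms in \<open>auto simp: PiE_iff extensional_def fun_eq_iff monoid.m_assoc intro: monoid.m_closed monoid.l_one monoid.r_one\<close>)

lemma satisfies_word_value: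
  "satisfies M (u, v) \<longleftrightarrow> (\<forall>\<theta>. range \<theta> \<subseteq> carrier M \<longrightarrow> word_value M \<theta> u = word_value M \<theta> v)"
  by (auto simp: satisfies_def eval_word_eq)

lemma satisfiesD:
  assumes "satisfies M (u, v)" "\<And>x. \<theta> x \<in> carrier M"
  shows "word_value M \<theta> u = word_value M \<theta> v"
  using assms by (auto simp: satisfies_word_value)

section \<open>Identities and Birkhoff's theorem\<close>

text \<open>Isomorphisms are not required to preserve the identity element, but surjectivity forces it.\<close>

lemma satisfies_iso:
  assumes "monoid M" "monoid N" "N \<cong> M"
  shows "satisfies N e \<longleftrightarrow> satisfies M e"
proof -
  obtain u v where e: "e = (u, v)" by (cases e)
  interpret M: monoid M by fact
  interpret N: monoid N by fact
  obtain h where h: "h \<in> hom N M" "h ` carrier N = carrier M" "inj_on h (carrier N)"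
    using assms(3) by (auto simp: is_iso_def iso_iff)
  have h1: "h \<one>\<^bsub>N\<^esub> = \<one>\<^bsub>M\<^esub>"
  proof -
    obtain x where x: "x \<in> carrier N" "h x = \<one>\<^bsub>M\<^esub>"
      using h(2) M.one_closed by (metis imageE)
    have "h \<one>\<^bsub>N\<^esub> = h \<one>\<^bsub>N\<^esub> \<otimes>\<^bsub>M\<^esub> h x"
      using x h(1) by (simp add: hom_in_carrier)
    also have "\<dots> = \<one>\<^bsub>M\<^esub>"
      using hom_mult[OF h(1) N.one_closed x(1)] x by simp
    finally show ?thesis .
  qed
  note ev = word_value_hom[OF \<open>monoid N\<close> h(1) h1]
  show ?thesis
  proof
    assume N: "satisfies N e"
    show "satisfies M e"
      unfolding e satisfies_word_value
    proof (intro allI impI)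
      fix \<theta> :: "nat \<Rightarrow> 'a" assume \<theta>: "range \<theta> \<subseteq> carrier M"
      define \<eta> where "\<eta> = inv_into (carrier N) h \<circ> \<theta>"
      have \<eta>: "\<eta> x \<in> carrier N" "h (\<eta> x) = \<theta> x" for x
        using \<theta> h(2) by (auto simp: \<eta>_def inv_into_into f_inv_into_f image_subset_iff)
      have "h \<circ> \<eta> = \<theta>" using \<eta> by auto
      then show "word_value M \<theta> u = word_value M \<theta> v"
        using ev[of u \<eta>] ev[of v \<eta>] \<eta>(1) satisfiesD[OF N[unfolded e], of \<eta>] by simp
    qed
  next
    assume M: "satisfies M e"
    show "satisfies N e"
      unfolding e satisfies_word_value
    proof (intro allI impI)
      fix \<theta> :: "nat \<Rightarrow> 'b" assume \<theta>: "range \<theta> \<subseteq> carrier N"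
      have "word_value M (h \<circ> \<theta>) u = word_value M (h \<circ> \<theta>) v"
        using \<theta> h(2) by (intro satisfiesD[OF M[unfolded e]]) auto
      then have "h (word_value N \<theta> u) = h (word_value N \<theta> v)"
        using ev[of u \<theta>] ev[of v \<theta>] \<theta> by (simp add: image_subset_iff)
      then show "word_value N \<theta> u = word_value N \<theta> v"
        using h(3) \<theta> by (auto dest!: inj_onD intro!: N.word_value_closed)
    qed
  qed
qed

lemma HSP_satisfies:
  assumes N: "N \<in> HSP K" and K: "\<And>M. M \<in> K \<Longrightarrow> monoid M \<and> satisfies M e"
  shows "satisfies N e"
proof -
  obtain u v where e: "e = (u, v)" by (cases e)
  obtain I :: "('a list \<times> 'a list) set" and G S h where G: "\<forall>i\<in>I. G i \<in> K" and S: "submonoid S (product_group I G)"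
    and h: "h \<in> hom (product_group I G\<lparr>carrier := S\<rparr>) N"
      "h \<one>\<^bsub>product_group I G\<^esub> = \<one>\<^bsub>N\<^esub>" "h ` S = carrier N"
    and "monoid N"
    using N by (auto simp: HSP_def hom_images_def submonoids_def direct_products_def)
  interpret P: monoid "product_group I G"
    using G K by (intro monoid_product) auto
  interpret S: submonoid S "product_group I G" by fact
  have mS: "monoid (product_group I G\<lparr>carrier := S\<rparr>)"
    using S.submonoid_is_monoid[OF P.monoid_axioms] .
  show ?thesis
    unfolding e satisfies_word_value
  proof (intro allI impI)
    fix \<theta> :: "nat \<Rightarrow> 'a" assume \<theta>: "range \<theta> \<subseteq> carrier N"
    define \<eta> where "\<eta> = inv_into S h \<circ> \<theta>"
    have \<eta>: "\<eta> x \<in> S" "h (\<eta> x) = \<theta> x" for x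
      using \<theta> h(3) by (auto simp: \<eta>_def inv_into_into f_inv_into_f image_subset_iff)
    have \<eta>P: "\<eta> x \<in> carrier (product_group I G)" for x
      using \<eta>(1) S.subset by blast
    have "word_value (product_group I G) \<eta> u = word_value (product_group I G) \<eta> v"
    proof (rule PiE_ext)
      show "word_value (product_group I G) \<eta> u \<in> (\<Pi>\<^sub>E i\<in>I. carrier (G i))"
        "word_value (product_group I G) \<eta> v \<in> (\<Pi>\<^sub>E i\<in>I. carrier (G i))"
        using P.word_value_closed[of _ \<eta>] \<eta>P by auto
      show "word_value (product_group I G) \<eta> u i = word_value (product_group I G) \<eta> v i"
        if "i \<in> I" for i
        unfolding word_value_product[OF that]
        using G K that \<eta>P e by (intro satisfiesD) auto
    qed
    moreover have "h \<circ> \<eta> = \<theta>" using \<eta> by auto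
    ultimately show "word_value N \<theta> u = word_value N \<theta> v"
      using word_value_hom[OF mS h(1), of u \<eta>] word_value_hom[OF mS h(1), of v \<eta>] \<eta>(1) h(2) by simp
  qed
qed

lemma variety_models: "variety (models \<Sigma>)"
  unfolding variety_def
proof (intro conjI ballI subsetI)
  fix N :: "'a monoid" assume N: "N \<in> HSP (models \<Sigma>)"
  show "N \<in> models \<Sigma>"
    using HSP_monoid[OF N] HSP_satisfies[OF N] by (auto simp: models_def)
qed (simp add: models_def)

lemma HSP_subset_generated_variety: "HSP K \<subseteq> generated_variety K"
  unfolding generated_variety_def
proof (rule Inter_greatest)
  fix V assume "V \<in> {V. variety V \<and> K \<subseteq> V}"
  then show "HSP K \<subseteq> V"
    using HSP_mono[of K V] by (auto simp: variety_def)
qed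

text \<open>Two words involve only finitely many letters, so countably many variables are enough to express
  an identity over any set of letters.\<close>

lemma satisfies_renamed:
  fixes u v :: "'x list"
  assumes M: "monoid M" and sat: "satisfies M (map \<rho> u, map \<rho> v)"
    and \<rho>: "inj_on \<rho> (set u \<union> set v)" and \<theta>: "\<And>x. x \<in> set u \<union> set v \<Longrightarrow> \<theta> x \<in> carrier M"
  shows "word_value M \<theta> u = word_value M \<theta> v"
proof -
  let ?X = "set u \<union> set v"
  define \<eta> where "\<eta> k = (if k \<in> \<rho> ` ?X then \<theta> (the_inv_into ?X \<rho> k) else \<one>\<^bsub>M\<^esub>)" for k
  have \<eta>: "\<eta> (\<rho> x) = \<theta> x" if "x \<in> ?X" for x
    using that \<rho> by (simp add: \<eta>_def the_inv_into_f_f)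
  have "\<eta> k \<in> carrier M" for k
  proof (cases "k \<in> \<rho> ` ?X")
    case True
    then show ?thesis using \<eta> \<theta> by auto
  qed (simp add: \<eta>_def monoid.one_closed[OF M])
  then have "word_value M \<eta> (map \<rho> u) = word_value M \<eta> (map \<rho> v)"
    by (rule satisfiesD[OF sat])
  moreover have "word_value M \<eta> (map \<rho> u) = word_value M \<theta> u" "word_value M \<eta> (map \<rho> v) = word_value M \<theta> v"
    unfolding word_value_map by (rule word_value_cong; simp add: \<eta>)+
  ultimately show ?thesis by simp
qed

text \<open>The monoid \<open>N\<close> is a quotient of a relatively free monoid on its own elements, realised inside a
  direct product. Two words over \<open>N\<close> with different values in \<open>N\<close> form an identity that fails in \<open>N\<close>,
  so it fails in some member of \<open>K\<close> under some substitution. These failures, one for each such pair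
  of words, are the coordinates of the product. By their choice, words that agree in the product
  have the same value in \<open>N\<close>.\<close>

theorem Birkhoff:
  fixes N :: "'u monoid"
  assumes N: "monoid N" and K: "\<And>M. M \<in> K \<Longrightarrow> monoid M"
    and sat: "\<And>e. (\<And>M. M \<in> K \<Longrightarrow> satisfies M e) \<Longrightarrow> satisfies N e"
  shows "N \<in> HSP K"
proof -
  interpret N: monoid N by fact
  let ?W = "lists (carrier N)" and ?val = "word_value N (\<lambda>x. x)"
  define I where "I = {(u, v). u \<in> ?W \<and> v \<in> ?W \<and> ?val u \<noteq> ?val v}"
  have "\<exists>M \<phi>. M \<in> K \<and> range \<phi> \<subseteq> carrier M \<and> word_value M \<phi> (fst i) \<noteq> word_value M \<phi> (snd i)"
    if "i \<in> I" for i
  proof -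
    obtain u v where i: "i = (u, v)" by (cases i)
    with that have uv: "u \<in> ?W" "v \<in> ?W" "?val u \<noteq> ?val v"
      by (simp_all add: I_def)
    obtain \<rho> :: "'u \<Rightarrow> nat" where \<rho>: "inj_on \<rho> (set u \<union> set v)"
      using finite_imp_inj_to_nat_seg[of "set u \<union> set v"] by auto
    have "\<not> satisfies N (map \<rho> u, map \<rho> v)"
      using satisfies_renamed[OF N _ \<rho>, of "\<lambda>x. x"] uv by auto
    then obtain M where M: "M \<in> K" "\<not> satisfies M (map \<rho> u, map \<rho> v)"
      using sat by blast
    then obtain \<theta> where "range \<theta> \<subseteq> carrier M"
        "word_value M \<theta> (map \<rho> u) \<noteq> word_value M \<theta> (map \<rho> v)"
      by (auto simp: satisfies_word_value)
    with M(1) show ?thesis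
      by (intro exI[of _ M] exI[of _ "\<theta> \<circ> \<rho>"]) (auto simp: i word_value_map)
  qed
  then obtain G \<phi> where G: "\<And>i. i \<in> I \<Longrightarrow> G i \<in> K"
    and \<phi>: "\<And>i. i \<in> I \<Longrightarrow> range (\<phi> i) \<subseteq> carrier (G i)"
    and sep: "\<And>i. i \<in> I \<Longrightarrow> word_value (G i) (\<phi> i) (fst i) \<noteq> word_value (G i) (\<phi> i) (snd i)"
    by metis
  let ?P = "product_group I G"
  define g where "g x = (\<lambda>i\<in>I. \<phi> i x)" for x
  interpret P: monoid ?P
    using G K by (intro monoid_product) auto
  have g: "g x \<in> carrier ?P" for x
    using \<phi>[THEN subsetD, OF _ rangeI] by (simp add: g_def)
  have gi: "word_value ?P g w i = word_value (G i) (\<phi> i) w" if "i \<in> I" for w i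
    using that by (simp add: word_value_product g_def)
  define S where "S = word_value ?P g ` ?W"
  have app: "word_value ?P g (u @ v) = word_value ?P g u \<otimes>\<^bsub>?P\<^esub> word_value ?P g v" for u v
    using g by (intro P.word_value_append)
  have S: "submonoid S ?P"
  proof
    show "S \<subseteq> carrier ?P"
      unfolding S_def by (intro image_subsetI P.word_value_closed g)
    show "\<one>\<^bsub>?P\<^esub> \<in> S"
      unfolding S_def by (rule image_eqI[of _ _ "[]"]) simp_all
    fix x y assume "x \<in> S" "y \<in> S"
    then obtain u v where "u \<in> ?W" "v \<in> ?W" "x = word_value ?P g u" "y = word_value ?P g v"
      unfolding S_def by blast
    then show "x \<otimes>\<^bsub>?P\<^esub> y \<in> S"
      unfolding S_def by (intro image_eqI[of _ _ "u @ v"]) (simp_all only: app append_in_lists_conv)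
  qed
  \<comment> \<open>Words with different values in \<open>N\<close> are separated by the coordinate that they index.\<close>
  have well: "?val u = ?val v" if "u \<in> ?W" "v \<in> ?W" "word_value ?P g u = word_value ?P g v" for u v
  proof (rule ccontr)
    assume "?val u \<noteq> ?val v"
    with that have uv: "(u, v) \<in> I" by (simp add: I_def)
    show False
      using sep[OF uv] gi[OF uv, of u] gi[OF uv, of v] that(3) by simp
  qed
  define h where "h s = ?val (SOME w. w \<in> ?W \<and> word_value ?P g w = s)" for s
  have h: "h (word_value ?P g w) = ?val w" if "w \<in> ?W" for w
    unfolding h_def
    by (rule someI2[of _ w]) (use that in \<open>auto intro: well\<close>)
  have val: "?val w \<in> carrier N" if "w \<in> ?W" for w
    using that by (intro N.word_value_closed) auto
  have val_app: "?val (u @ v) = ?val u \<otimes>\<^bsub>N\<^esub> ?val v" if "u \<in> ?W" "v \<in> ?W" for u v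
    using that by (intro N.word_value_append) auto
  have "h \<in> hom (?P\<lparr>carrier := S\<rparr>) N"
  proof (rule homI)
    fix x assume "x \<in> carrier (?P\<lparr>carrier := S\<rparr>)"
    then obtain w where "w \<in> ?W" "x = word_value ?P g w"
      unfolding S_def by auto
    then show "h x \<in> carrier N"
      using h val by simp
  next
    fix x y assume "x \<in> carrier (?P\<lparr>carrier := S\<rparr>)" "y \<in> carrier (?P\<lparr>carrier := S\<rparr>)"
    then obtain u v where uv: "u \<in> ?W" "v \<in> ?W" "x = word_value ?P g u" "y = word_value ?P g v"
      unfolding S_def by auto
    have "h (x \<otimes>\<^bsub>?P\<^esub> y) = ?val (u @ v)"
      unfolding uv(3,4) app[symmetric] using uv by (intro h) auto
    then show "h (x \<otimes>\<^bsub>?P\<lparr>carrier := S\<rparr>\<^esub> y) = h x \<otimes>\<^bsub>N\<^esub> h y"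
      using uv by (simp add: h val_app del: mult_product_group)
  qed
  moreover have "h \<one>\<^bsub>?P\<^esub> = \<one>\<^bsub>N\<^esub>"
    using h[of "[]"] by simp
  moreover have "h ` S = carrier N"
  proof
    show "h ` S \<subseteq> carrier N"
    proof
      fix x assume "x \<in> h ` S"
      then obtain w where "w \<in> ?W" "x = h (word_value ?P g w)"
        unfolding S_def by blast
      then show "x \<in> carrier N"
        using h val by simp
    qed
    show "carrier N \<subseteq> h ` S"
    proof
      fix x assume x: "x \<in> carrier N"
      then have "[x] \<in> ?W" by simp
      moreover have "h (word_value ?P g [x]) = x"
        using x h[of "[x]"] by simp
      ultimately show "x \<in> h ` S"
        unfolding S_def by (metis imageI)
    qed
  qed
  moreover have "?P\<lparr>carrier := S\<rparr> \<in> submonoids (direct_products K)"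
  proof -
    have "?P \<in> direct_products K"
      unfolding direct_products_def using G by blast
    with S show ?thesis
      unfolding submonoids_def by blast
  qed
  ultimately show ?thesis
    unfolding HSP_def hom_images_def using N
    by (intro CollectI conjI bexI[of _ "?P\<lparr>carrier := S\<rparr>"] bexI[of _ h]) simp_all
qed

section \<open>The identity \<open>xyx = yxx\<close>\<close>

abbreviation "stal_identity \<equiv> ([0, 1, 0], [1, 0, 0]) :: nat list \<times> nat list"

lemma satisfies_stal_identity:
  "satisfies M stal_identity \<longleftrightarrow> (\<forall>a\<in>carrier M. \<forall>b\<in>carrier M.
     a \<otimes>\<^bsub>M\<^esub> (b \<otimes>\<^bsub>M\<^esub> (a \<otimes>\<^bsub>M\<^esub> \<one>\<^bsub>M\<^esub>)) = b \<otimes>\<^bsub>M\<^esub> (a \<otimes>\<^bsub>M\<^esub> (a \<otimes>\<^bsub>M\<^esub> \<one>\<^bsub>M\<^esub>)))" (is "_ \<longleftrightarrow> ?r")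
proof
  assume L: "satisfies M stal_identity"
  show ?r
  proof (intro ballI)
    fix a b assume "a \<in> carrier M" "b \<in> carrier M"
    then show "a \<otimes>\<^bsub>M\<^esub> (b \<otimes>\<^bsub>M\<^esub> (a \<otimes>\<^bsub>M\<^esub> \<one>\<^bsub>M\<^esub>)) = b \<otimes>\<^bsub>M\<^esub> (a \<otimes>\<^bsub>M\<^esub> (a \<otimes>\<^bsub>M\<^esub> \<one>\<^bsub>M\<^esub>))"
      using satisfiesD[OF L, of "\<lambda>k. if k = 0 then a else b"] by auto
  qed
qed (auto simp: satisfies_word_value image_subset_iff)

text \<open>When a letter \<open>a\<close> is put in front of a word \<open>u\<close> already in normal form \<open>X a Z\<close>, with the block
  of \<open>a\<close>'s beginning after \<open>X\<close>, the identity with \<open>x = a\<close> and \<open>y = X\<close> moves the new letter into the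
  block: \<open>a X a Z = X a a Z\<close>. This is stalactic insertion of \<open>a\<close> at the bottom of its column.\<close>

lemma word_value_P_stal:
  fixes G :: "'a monoid" (structure)
  assumes "monoid G" and sat: "satisfies G stal_identity" and \<theta>: "\<And>x. \<theta> x \<in> carrier G"
  shows "word_value G \<theta> (concat (P_stal u)) = word_value G \<theta> u"
proof (induction u)
  case (Cons a u)
  interpret monoid G by fact
  note wc = word_value_closed[of _ \<theta>, OF \<theta>]
  note wa = word_value_append[of _ \<theta>, OF \<theta> \<theta>]
  show ?case
  proof (cases "a \<in> set u")
    case True
    obtain xs ys where r: "remdups u = xs @ a # ys"
      using True by (metis split_list set_remdups)
    have d: "a \<notin> set xs" "a \<notin> set ys"
      using distinct_remdups[of u] by (auto simp: r)
    obtain k where k: "count_list u a = Suc k"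
      using True by (metis count_list_0_iff not0_implies_Suc)
    define X Z where "X = concat (map (\<lambda>b. replicate (count_list u b) b) xs)"
      and "Z = replicate k a @ concat (map (\<lambda>b. replicate (count_list u b) b) ys)"
    have u: "concat (P_stal u) = X @ a # Z"
      by (simp add: P_stal_eq r k X_def Z_def)
    have "count_list (a # u) b = count_list u b" if "b \<in> set xs \<union> set ys" for b
      using that d by auto
    moreover have "count_list (a # u) a = Suc (Suc k)"
      using k by simp
    ultimately have au: "concat (P_stal (a # u)) = X @ a # a # Z"
      using True by (simp add: P_stal_eq r X_def Z_def del: count_list.simps cong: map_cong)
    have "\<theta> a \<otimes> (word_value G \<theta> X \<otimes> (\<theta> a \<otimes> \<one>)) = word_value G \<theta> X \<otimes> (\<theta> a \<otimes> (\<theta> a \<otimes> \<one>))"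
      using sat \<theta> wc unfolding satisfies_stal_identity by blast
    then have "word_value G \<theta> X \<otimes> (\<theta> a \<otimes> \<theta> a) = \<theta> a \<otimes> (word_value G \<theta> X \<otimes> \<theta> a)"
      by (simp add: \<theta>)
    from arg_cong[OF this, of "\<lambda>t. t \<otimes> word_value G \<theta> Z"]
    have "word_value G \<theta> (X @ a # a # Z) = word_value G \<theta> (a # X @ a # Z)"
      by (simp add: wa wc \<theta> m_assoc)
    also have "\<dots> = word_value G \<theta> (a # u)"
      using Cons.IH by (simp add: u)
    finally show ?thesis by (simp add: au)
  next
    case False
    have "count_list (a # u) b = count_list u b" if "b \<in> set u" for b
      using that False by auto
    then have "map (\<lambda>b. replicate (count_list (a # u) b) b) (remdups u) = P_stal u"
      unfolding P_stal_eq by (intro map_cong refl) simp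
    moreover have "count_list (a # u) a = 1"
      using False by (simp add: count_list_0_iff)
    ultimately have "concat (P_stal (a # u)) = a # concat (P_stal u)"
      unfolding P_stal_eq[of "a # u"] using False by (simp del: count_list.simps)
    then show ?thesis using Cons.IH by simp
  qed
qed (simp add: P_stal_def)

lemma satisfies_if_P_stal_eq:
  assumes "monoid M" "satisfies M stal_identity" "P_stal u = P_stal v"
  shows "satisfies M (u, v)"
  unfolding satisfies_word_value
proof (intro allI impI)
  fix \<theta> :: "nat \<Rightarrow> 'a" assume "range \<theta> \<subseteq> carrier M"
  then show "word_value M \<theta> u = word_value M \<theta> v"
    using word_value_P_stal[OF assms(1,2), of \<theta>] assms(3) by (metis rangeI subsetD)
qed

text \<open>An identity that holds in \<open>K\<close> has sides with equal tableaux, hence equal normal forms in every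
  model of \<open>xyx = yxx\<close>; so Birkhoff's theorem applies.\<close>

lemma models_subset_generated_variety:
  assumes "\<And>M. M \<in> K \<Longrightarrow> monoid M"
    and "\<And>u v. (\<And>M. M \<in> K \<Longrightarrow> satisfies M (u, v)) \<Longrightarrow> P_stal u = P_stal v"
  shows "models {stal_identity} \<subseteq> generated_variety K"
proof
  fix N :: "'a monoid" assume "N \<in> models {stal_identity}"
  then have N: "monoid N" "satisfies N stal_identity"
    by (simp_all add: models_def)
  have "satisfies N (u, v)" if "\<And>M. M \<in> K \<Longrightarrow> satisfies M (u, v)" for u v
    using N assms(2)[OF that] by (rule satisfies_if_P_stal_eq)
  then have "N \<in> HSP K"
    using N(1) assms(1) by (intro Birkhoff) auto
  then show "N \<in> generated_variety K"
    using HSP_subset_generated_variety by blast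
qed

section \<open>Order of last occurrences\<close>

text \<open>For \<open>x \<noteq> y\<close> this says that \<open>x\<close> occurs with no \<open>y\<close> to its right; the letter \<open>y\<close> need not
  occur at all.\<close>

fun last_after :: "'a \<Rightarrow> 'a \<Rightarrow> 'a list \<Rightarrow> bool" where
  "last_after x y [] = False"
| "last_after x y (a # w) = (last_after x y w \<or> a = x \<and> y \<notin> set w)"

lemma last_after_set: "last_after x y w \<Longrightarrow> x \<in> set w"
  by (induction w) auto

lemma last_afterI: "x \<in> set w \<Longrightarrow> y \<notin> set w \<Longrightarrow> last_after x y w"
  by (induction w) auto

lemma last_after_remdups: "x \<noteq> y \<Longrightarrow> last_after x y (remdups w) = last_after x y w"
  by (induction w) (auto intro: last_afterI)

text \<open>A duplicate-free list is a linear order on its elements, which \<open>last_after\<close> determines. In the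
  induction, different first letters \<open>a\<close> and \<open>b\<close> are impossible, since \<open>a\<close> would stand before \<open>b\<close> in
  one list and after it in the other.\<close>

lemma distinct_eqI_last_after:
  assumes "distinct u" "distinct v" "set u = set v"
    and "\<And>x y. x \<noteq> y \<Longrightarrow> last_after x y u = last_after x y v"
  shows "u = v"
  using assms
proof (induction u arbitrary: v)
  case (Cons a u)
  then obtain b w where v: "v = b # w" by (cases v) auto
  have "a = b"
  proof (rule ccontr)
    assume "a \<noteq> b"
    moreover have "insert a (set u) = insert b (set w)"
      using Cons.prems(3) by (simp add: v)
    ultimately have "a \<notin> set u" "b \<in> set u" "a \<in> set w" "b \<notin> set w"
      using Cons.prems(1,2) by (auto simp: v)
    then show False
      using Cons.prems(4)[OF \<open>a \<noteq> b\<close>] by (auto simp: v dest: last_after_set intro: last_afterI)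
  qed
  moreover have "u = w"
  proof (rule Cons.IH)
    show "distinct u" "distinct w" "set u = set w"
      using Cons.prems \<open>a = b\<close> by (simp_all add: v insert_ident)
    fix x y :: 'a assume "x \<noteq> y"
    show "last_after x y u = last_after x y w"
    proof (cases "x = a")
      case True
      then show ?thesis
        using Cons.prems \<open>a = b\<close> v by (auto dest: last_after_set)
    next
      case False
      then show ?thesis
        using Cons.prems(4)[OF \<open>x \<noteq> y\<close>] \<open>a = b\<close> v by auto
    qed
  qed
  ultimately show ?case by (simp add: v)
qed simp

text \<open>The columns of a tableau are ordered as the last occurrences in the word, and their heights are
  the numbers of occurrences.\<close>

lemma P_stal_eqI:
  assumes "\<And>x. count_list u x = count_list v x"
    and "\<And>x y. x \<noteq> y \<Longrightarrow> last_after x y u = last_after x y v"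
  shows "P_stal u = P_stal v"
proof -
  have "set u = set v"
    using assms(1) by (metis count_list_0_iff subsetI subset_antisym)
  then have "remdups u = remdups v"
    using assms(2) by (intro distinct_eqI_last_after) (auto simp: last_after_remdups)
  with assms(1) show ?thesis by (simp add: P_stal_eq_iff)
qed

section \<open>Stalactic monoids\<close>

lemma word_value_stal:
  assumes "\<And>x. \<theta> x = stal_equiv A `` {f x}" "\<And>x. f x \<in> lists A"
  shows "word_value (stal_over A) \<theta> w = stal_equiv A `` {concat (map f w)}"
proof (induction w)
  case (Cons a w)
  have "concat (map f w) \<in> lists A"
    using assms(2) by (induction w) auto
  with Cons assms show ?case by (simp add: stal_mult_class)
qed (simp add: stal_over_def)

lemma stal_class_eq_iff:
  assumes "u \<in> lists A" "v \<in> lists A"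
  shows "stal_equiv A `` {u} = stal_equiv A `` {v} \<longleftrightarrow> P_stal u = P_stal v"
  using eq_equiv_class_iff[OF equiv_stal assms] assms by (simp add: stal_equiv_def)

lemma stal_over_satisfies_stal_identity: "satisfies (stal_over A) stal_identity"
  unfolding satisfies_word_value
proof (intro allI impI)
  fix \<theta> :: "nat \<Rightarrow> nat list set" assume "range \<theta> \<subseteq> carrier (stal_over A)"
  then have "\<theta> x \<in> carrier (stal_over A)" for x
    by blast
  then have "\<exists>w\<in>lists A. \<theta> x = stal_equiv A `` {w}" for x
    by (simp add: stal_over_def) (metis quotientE)
  then obtain f where f: "\<And>x. f x \<in> lists A" "\<And>x. \<theta> x = stal_equiv A `` {f x}"
    by metis
  have *: "remdups (p @ q) = filter (\<lambda>x. x \<notin> set q) (remdups p) @ remdups q" for p q :: "nat list"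
    by (induction p) auto
  have "P_stal (f 0 @ f 1 @ f 0) = P_stal (f 1 @ f 0 @ f 0)"
    unfolding P_stal_eq_iff by (auto simp: * filter_empty_conv intro: filter_cong)
  moreover have "f i @ f j @ f k \<in> lists A" for i j k using f(1) by auto
  ultimately show "word_value (stal_over A) \<theta> [0, 1, 0] = word_value (stal_over A) \<theta> [1, 0, 0]"
    unfolding word_value_stal[OF f(2,1)] using f(1) stal_class_eq_iff by simp
qed

text \<open>Sending one letter to \<open>a\<close> and the others to the empty word counts that letter; sending two letters
  to \<open>a\<close> and \<open>b\<close> and the others to the empty word retains the order of their last occurrences.\<close>

lemma stal_over_separates:
  assumes ab: "a \<in> A" "b \<in> A" "a \<noteq> b" and sat: "satisfies (stal_over A) (u, v)"
  shows "P_stal u = P_stal v"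
proof -
  have P: "P_stal (concat (map f u)) = P_stal (concat (map f v))" if f: "\<And>x. f x \<in> lists A" for f
  proof -
    define \<theta> where "\<theta> x = stal_equiv A `` {f x}" for x
    have "\<theta> x \<in> carrier (stal_over A)" for x
      using f by (auto simp: \<theta>_def stal_over_def intro: quotientI)
    then have "word_value (stal_over A) \<theta> u = word_value (stal_over A) \<theta> v"
      by (rule satisfiesD[OF sat])
    then have "stal_equiv A `` {concat (map f u)} = stal_equiv A `` {concat (map f v)}"
      unfolding word_value_stal[of \<theta> A f, OF \<theta>_def f] .
    moreover have "concat (map f w) \<in> lists A" for w
      using f by (induction w) auto
    ultimately show ?thesis
      by (subst (asm) stal_class_eq_iff)
  qed
  show ?thesis
  proof (rule P_stal_eqI)
    fix x :: nat
    have "count_list w x = count_list (concat (map (\<lambda>z. if z = x then [a] else []) w)) a" for w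
      by (induction w) auto
    then show "count_list u x = count_list v x"
      using P[of "\<lambda>z. if z = x then [a] else []"] ab by (simp add: P_stal_eq_iff)
  next
    fix x y :: nat assume xy: "x \<noteq> y"
    define f where "f z = (if z = x then [a] else if z = y then [b] else [])" for z
    have y: "b \<in> set (concat (map f w)) \<longleftrightarrow> y \<in> set w" for w
      using xy ab by (induction w) (auto simp: f_def)
    have "last_after x y w \<longleftrightarrow> last_after a b (concat (map f w))" for w
      using xy ab y by (induction w) (auto simp: f_def simp del: set_concat)
    then have "last_after x y w \<longleftrightarrow> last_after a b (remdups (concat (map f w)))" for w
      using ab by (simp add: last_after_remdups)
    then show "last_after x y u = last_after x y v"
      using P[of f] ab by (simp add: P_stal_eq_iff f_def)
  qed
qed

lemma countable_stal_over: "countable (carrier (stal_over A))"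
  by (simp add: stal_over_def quotient_def)

section \<open>Varieties generated by a single monoid\<close>

text \<open>Countability ensures that the universe contains a copy of \<open>M\<close>; without one, the left-hand side
  would hold vacuously.\<close>

lemma copies_satisfies:
  fixes M :: "'a monoid"
  assumes "monoid M" "countable (carrier M)"
  shows "(\<forall>N\<in>copies M :: 'u::infinite monoid set. satisfies N e) \<longleftrightarrow> satisfies M e"
proof -
  obtain N :: "'u monoid" where "N \<in> copies M"
    using copies_nonempty[OF assms] by blast
  then show ?thesis
    using satisfies_iso[OF assms(1)] unfolding copies_def by blast
qed

lemma copies_subset_models:
  assumes "monoid M" "\<And>e. e \<in> \<Sigma> \<Longrightarrow> satisfies M e"
  shows "copies M \<subseteq> models \<Sigma>"
proof
  fix N assume "N \<in> copies M"
  then have "monoid N" "N \<cong> M" by (simp_all add: copies_def)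
  then show "N \<in> models \<Sigma>"
    using assms(2) satisfies_iso[OF assms(1)] unfolding models_def by blast
qed

lemma models_subset_variety_of:
  assumes "monoid M" "countable (carrier M)" "\<And>u v. satisfies M (u, v) \<Longrightarrow> P_stal u = P_stal v"
  shows "(models {stal_identity} :: 'u::infinite monoid set) \<subseteq> variety_of M"
  unfolding variety_of_def
proof (rule models_subset_generated_variety)
  show "monoid N" if "N \<in> copies M" for N :: "'u monoid"
    using that by (simp add: copies_def)
  fix u v assume "\<And>N :: 'u monoid. N \<in> copies M \<Longrightarrow> satisfies N (u, v)"
  then have "satisfies M (u, v)"
    using copies_satisfies[OF assms(1,2)] by blast
  then show "P_stal u = P_stal v"
    by (rule assms(3))
qed

lemma variety_of_stal_over:
  assumes "a \<in> A" "b \<in> A" "a \<noteq> b"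
  shows "(variety_of (stal_over A) :: 'u::infinite monoid set) = models {stal_identity}"
proof
  show "variety_of (stal_over A) \<subseteq> models {stal_identity}"
    unfolding variety_of_def
    by (intro generated_variety_least variety_models copies_subset_models monoid_stal_over)
      (use stal_over_satisfies_stal_identity in blast)
  show "(models {stal_identity} :: 'u monoid set) \<subseteq> variety_of (stal_over A)"
    using stal_over_separates[OF assms]
    by (intro models_subset_variety_of monoid_stal_over countable_stal_over)
qed

section \<open>The bicyclic monoid\<close>

lemma bicyclic_simps [simp]:
  "carrier bicyclic = UNIV"
  "(i, j) \<otimes>\<^bsub>bicyclic\<^esub> (k, l) = (i + (k - j), l + (j - k))"
  "\<one>\<^bsub>bicyclic\<^esub> = (0, 0)"
  by (simp_all add: bicyclic_def)

text \<open>The order of last occurrences is detected by \<open>x \<mapsto> p\<close>, \<open>y \<mapsto> q\<^sup>m\<close>. Reading a word from right to left,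
  the letters \<open>x\<close> to the right of every \<open>y\<close> accumulate in the exponent of \<open>p\<close>. From the last \<open>y\<close> on
  there are \<open>m\<close> factors \<open>q\<close> in front, and \<open>pq = 1\<close> makes each further \<open>x\<close> consume one of them. If
  \<open>m\<close> is at least the number of occurrences of \<open>x\<close>, this supply is never exhausted, and the exponent
  of \<open>p\<close> stays at the number of \<open>x\<close>'s after the last \<open>y\<close>.\<close>

lemma bicyclic_separates:
  assumes sat: "satisfies bicyclic (u, v)"
  shows "P_stal u = P_stal v"
proof (rule P_stal_eqI)
  fix x :: nat
  have "word_value bicyclic (\<lambda>z. if z = x then (0, 1) else (0, 0)) w = (0, count_list w x)" for w
    by (induction w) auto
  then show "count_list u x = count_list v x"
    using satisfiesD[OF sat, of "\<lambda>z. if z = x then (0, 1) else (0, 0)"] by simp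
next
  fix x y :: nat assume xy: "x \<noteq> y"
  \<comment> \<open>The sum bounds the number of occurrences of \<open>x\<close> in both words.\<close>
  define m where "m = count_list u x + count_list v x"
  define \<theta> :: "nat \<Rightarrow> nat \<times> nat" where "\<theta> z = (if z = x then (0, 1) else if z = y then (m, 0) else (0, 0))" for z
  have \<theta>: "\<theta> x = (0, 1)" "\<theta> y = (m, 0)" "z \<noteq> x \<Longrightarrow> z \<noteq> y \<Longrightarrow> \<theta> z = (0, 0)" for z
    using xy by (simp_all add: \<theta>_def)
  have *: "(if y \<in> set w then m \<le> fst (word_value bicyclic \<theta> w) + count_list w x
            else fst (word_value bicyclic \<theta> w) = 0)
         \<and> (snd (word_value bicyclic \<theta> w) > 0 \<longleftrightarrow> last_after x y w)"
    if "count_list w x \<le> m" for w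
    using that
  proof (induction w)
    case (Cons a w)
    obtain k l where kl: "word_value bicyclic \<theta> w = (k, l)" by fastforce
    have "count_list w x \<le> m" using Cons.prems by (auto split: if_splits)
    with Cons kl have IH: "if y \<in> set w then m \<le> k + count_list w x else k = 0"
      "l > 0 \<longleftrightarrow> last_after x y w" by auto
    consider "a = x" | "a = y" | "a \<noteq> x" "a \<noteq> y" by blast
    then show ?case
    proof cases
      case 1
      then show ?thesis using IH Cons.prems xy kl by (auto simp: \<theta> split: if_splits)
    next
      case 2
      then show ?thesis using IH Cons.prems xy kl by (auto simp: \<theta> split: if_splits)
    next
      case 3
      then show ?thesis using IH Cons.prems xy kl by (auto simp: \<theta> split: if_splits)
    qed
  qed simp
  have "word_value bicyclic \<theta> u = word_value bicyclic \<theta> v"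
    by (rule satisfiesD[OF sat]) simp
  then show "last_after x y u = last_after x y v"
    using *[of u] *[of v] by (simp add: m_def)
qed

lemma models_psubset_variety_B:
  "proper_subvariety (models {stal_identity}) (variety_B :: 'u::infinite monoid set)"
  unfolding proper_subvariety_def
proof (intro conjI psubsetI)
  show "variety (models {stal_identity} :: 'u monoid set)" by (rule variety_models)
  show "variety (variety_B :: 'u monoid set)"
    unfolding variety_B_def variety_of_def
    by (rule variety_generated_variety) (simp add: copies_def)
  have c: "countable (carrier bicyclic)" by simp
  show "(models {stal_identity} :: 'u monoid set) \<subseteq> variety_B"
    unfolding variety_B_def
    by (intro models_subset_variety_of monoid_bicyclic c bicyclic_separates)
  show "(models {stal_identity} :: 'u monoid set) \<noteq> variety_B"
  proof
    assume eq: "(models {stal_identity} :: 'u monoid set) = variety_B"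
    have "(copies bicyclic :: 'u monoid set) \<subseteq> variety_B"
      by (auto simp: variety_B_def variety_of_def generated_variety_def)
    then have "\<forall>N\<in>copies bicyclic :: 'u monoid set. satisfies N stal_identity"
      unfolding eq[symmetric] by (auto simp: models_def)
    then have "satisfies bicyclic stal_identity"
      by (simp only: copies_satisfies[OF monoid_bicyclic c])
    \<comment> \<open>The substitution \<open>x = p\<close>, \<open>y = q\<close> yields \<open>p\<close> on the left and \<open>qpp\<close> on the right.\<close>
    from satisfiesD[OF this, of "\<lambda>z. if z = 0 then (0, 1) else (1, 0)"] show False by simp
  qed
qed

section \<open>The join of commutative monoids and right regular bands\<close>

lemma Comm_eq_models: "Comm = models {([0, 1], [1, 0])}"
proof (intro subset_antisym subsetI)
  fix M :: "'a monoid" assume "M \<in> Comm"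
  then interpret comm_monoid M by (simp add: Comm_def)
  show "M \<in> models {([0, 1], [1, 0])}"
    by (auto simp: models_def satisfies_word_value image_subset_iff m_comm monoid_axioms)
next
  fix M :: "'a monoid" assume "M \<in> models {([0, 1], [1, 0])}"
  then have M: "monoid M" and sat: "satisfies M ([0, 1], [1, 0])" by (auto simp: models_def)
  interpret monoid M by fact
  have "comm_monoid M"
  proof (rule monoid_comm_monoidI)
    fix a b assume "a \<in> carrier M" "b \<in> carrier M"
    then show "a \<otimes>\<^bsub>M\<^esub> b = b \<otimes>\<^bsub>M\<^esub> a"
      using satisfiesD[OF sat, of "\<lambda>k. if k = 0 then a else b"] by auto
  qed
  then show "M \<in> Comm" by (simp add: Comm_def)
qed

definition nat_add_monoid :: "nat monoid" where
  "nat_add_monoid = \<lparr>carrier = UNIV, mult = (+), one = 0\<rparr>"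

text \<open>The semigroup on \<open>{Some True, Some False}\<close> with \<open>ab = b\<close>, together with an adjoined identity
  element \<open>None\<close>.\<close>

definition right_zero_monoid :: "bool option monoid" where
  "right_zero_monoid = \<lparr>carrier = UNIV, mult = (\<lambda>a b. if b = None then a else b), one = None\<rparr>"

lemma Comm_separates:
  assumes "\<And>M. M \<in> (Comm :: 'u::infinite monoid set) \<Longrightarrow> satisfies M (u, v)"
  shows "count_list u x = count_list v x"
proof -
  have M: "monoid nat_add_monoid"
    by (rule monoidI) (auto simp: nat_add_monoid_def)
  have "(copies nat_add_monoid :: 'u monoid set) \<subseteq> Comm"
    unfolding Comm_eq_models using M
    by (intro copies_subset_models) (auto simp: satisfies_word_value nat_add_monoid_def)
  with assms have "\<forall>N\<in>copies nat_add_monoid :: 'u monoid set. satisfies N (u, v)" by blast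
  then have sat: "satisfies nat_add_monoid (u, v)"
    by (subst (asm) copies_satisfies[OF M]) simp_all
  have "word_value nat_add_monoid (\<lambda>z. if z = x then 1 else 0) w = count_list w x" for w
    by (induction w) (auto simp: nat_add_monoid_def)
  then show ?thesis
    using satisfiesD[OF sat, of "\<lambda>z. if z = x then 1 else 0"] by (simp add: nat_add_monoid_def)
qed

lemma RRB_separates:
  assumes "\<And>M. M \<in> (RRB :: 'u::infinite monoid set) \<Longrightarrow> satisfies M (u, v)" and xy: "x \<noteq> y"
  shows "last_after x y u = last_after x y v"
proof -
  have M: "monoid right_zero_monoid"
    by (rule monoidI) (auto simp: right_zero_monoid_def)
  have "(copies right_zero_monoid :: 'u monoid set) \<subseteq> RRB"
    unfolding RRB_def using M
    by (intro copies_subset_models) (auto simp: satisfies_word_value right_zero_monoid_def)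
  with assms have "\<forall>N\<in>copies right_zero_monoid :: 'u monoid set. satisfies N (u, v)" by blast
  then have sat: "satisfies right_zero_monoid (u, v)"
    by (subst (asm) copies_satisfies[OF M]) simp_all
  define \<theta> where "\<theta> z = (if z = x then Some True else if z = y then Some False else None)" for z
  \<comment> \<open>The value of a word is the image of its last letter among \<open>x\<close> and \<open>y\<close>. The first conjunct makes
    the induction work: a letter \<open>x\<close> in front matters only if neither letter follows.\<close>
  have *: "(word_value right_zero_monoid \<theta> w = None \<longleftrightarrow> x \<notin> set w \<and> y \<notin> set w)
         \<and> (word_value right_zero_monoid \<theta> w = Some True \<longleftrightarrow> last_after x y w)" for w
    using xy by (induction w) (auto simp: right_zero_monoid_def \<theta>_def dest: last_after_set intro: last_afterI)
  have "word_value right_zero_monoid \<theta> u = word_value right_zero_monoid \<theta> v"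
    by (rule satisfiesD[OF sat]) (simp add: right_zero_monoid_def)
  then show ?thesis
    using *[of u] *[of v] by metis
qed

lemma Comm_subset_models: "Comm \<subseteq> models {stal_identity}"
proof
  fix M :: "'a monoid" assume "M \<in> Comm"
  then interpret comm_monoid M by (simp add: Comm_def)
  have "satisfies M stal_identity"
    unfolding satisfies_stal_identity by (simp add: m_lcomm)
  then show "M \<in> models {stal_identity}"
    by (simp add: models_def monoid_axioms)
qed

lemma RRB_subset_models: "RRB \<subseteq> models {stal_identity}"
proof
  fix M :: "'a monoid" assume "M \<in> RRB"
  then have M: "monoid M" and 1: "satisfies M ([0, 0], [0])" and 2: "satisfies M ([0, 1, 0], [1, 0])"
    by (auto simp: RRB_def models_def)
  interpret monoid M by fact
  show "M \<in> models {stal_identity}"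
    using M satisfiesD[OF 1] satisfiesD[OF 2]
    by (simp add: models_def satisfies_word_value image_subset_iff)
qed

lemma variety_join_Comm_RRB:
  "(variety_join Comm RRB :: 'u::infinite monoid set) = models {stal_identity}"
  unfolding variety_join_def
proof
  show "generated_variety (Comm \<union> RRB) \<subseteq> (models {stal_identity} :: 'u monoid set)"
    by (intro generated_variety_least variety_models Un_least Comm_subset_models RRB_subset_models)
  show "(models {stal_identity} :: 'u monoid set) \<subseteq> generated_variety (Comm \<union> RRB)"
  proof (rule models_subset_generated_variety)
    show "monoid M" if "M \<in> Comm \<union> RRB" for M :: "'u monoid"
      using that by (auto simp: Comm_eq_models RRB_def models_def)
    show "P_stal u = P_stal v" if "\<And>M :: 'u monoid. M \<in> Comm \<union> RRB \<Longrightarrow> satisfies M (u, v)" for u v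
      using that by (intro P_stal_eqI Comm_separates RRB_separates) auto
  qed
qed

theorem corollary4p7:
  fixes n :: nat
  assumes "n \<ge> 2"
  shows "proper_subvariety (variety_of (stal_rank n) :: 'u::infinite monoid set) variety_B
       \<and> (variety_of (stal_rank n) :: 'u monoid set) = variety_join Comm RRB
       \<and> (variety_of (stal_rank n) :: 'u monoid set) = models {([0, 1, 0], [1, 0, 0])}
       \<and> (variety_of (stal_rank n) :: 'u monoid set) = variety_of stal"
proof -
  have "(variety_of (stal_rank n) :: 'u monoid set) = models {stal_identity}"
    unfolding stal_rank_def using assms by (intro variety_of_stal_over[of 1 _ 2]) auto
  moreover have "(variety_of stal :: 'u monoid set) = models {stal_identity}"
    unfolding stal_def by (intro variety_of_stal_over[of 1 _ 2]) auto
  ultimately show ?thesis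
    by (simp only: models_psubset_variety_B variety_join_Comm_RRB simp_thms)
qed

end
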